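(* Let $X$ be a nonempty set, let $\mathcal{F}$ be a family of subsets of $X$ which is closed under intersection and contains $X$, and let $L$ be a complete lattice. There exists a unique $L$-fuzzy set $\mu:X\to L$ such that $\mathcal{F}=\mu_L$ if and only if $|\mathcal{S}(L,\mathcal{F})|=|OI(\mathcal{F})|=1$.
   Context: An $L$-fuzzy set on $X$ is a map $\mu:X\to L$; for $p\in L$, $\mu_p=\{x\in X\mid\mu(x)\geq p\}$ and $\mu_L=\{\mu_p\mid p\in L\}$. $|A|$ denotes cardinality. For a subset $P\subseteq L$ with the induced order, "$P$ can be embedded into $L$ by $\iota_{(P,L)}$-embedding" means that the inclusion map $P\to L$ preserves all infima and the top element: for every $S\subseteq P$ the infimum of $S$ in $P$ exists and equals its infimum in $L$, and the top of $P$ is $1_L$. $\mathcal{S}(L,\mathcal{F})=\{P\subseteq L\mid P\text{ can be embedded into }L\text{ by }\iota_{(P,L)}\text{-embedding and }(P,\leq)\cong(\mathcal{F},\supseteq)\}$. $OI(\mathcal{F})$ denotes the set of lattice isomorphisms of the lattice $(\mathcal{F},\supseteq)$ onto itself. *)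

theory Defs
  imports "HOL-Algebra.Complete_Lattice"
begin

text \<open>An \<open>L\<close>-fuzzy set on \<open>X\<close> is an element of \<open>X \<rightarrow>\<^sub>E carrier L\<close>: fixing the value outside
  \<open>X\<close> makes equality of such maps agree with equality on \<open>X\<close>. The same convention is
  used for the self-maps counted by \<open>lattice_autos\<close>.\<close>

definition level_set :: "('l, 'm) gorder_scheme \<Rightarrow> 'a set \<Rightarrow> ('a \<Rightarrow> 'l) \<Rightarrow> 'l \<Rightarrow> 'a set"
  where "level_set L X \<mu> p = {x \<in> X. p \<sqsubseteq>\<^bsub>L\<^esub> \<mu> x}"

definition level_sets :: "('l, 'm) gorder_scheme \<Rightarrow> 'a set \<Rightarrow> ('a \<Rightarrow> 'l) \<Rightarrow> 'a set set"
  where "level_sets L X \<mu> = {level_set L X \<mu> p | p. p \<in> carrier L}"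

definition superset_order :: "'a set set \<Rightarrow> 'a set gorder"
  where "superset_order F = \<lparr>carrier = F, eq = (=), le = (\<lambda>A B. A \<supseteq> B)\<rparr>"

abbreviation suborder :: "('l, 'm) gorder_scheme \<Rightarrow> 'l set \<Rightarrow> ('l, 'm) gorder_scheme"
  where "suborder L P \<equiv> L\<lparr>carrier := P\<rparr>"

definition iota_embeddable :: "('l, 'm) gorder_scheme \<Rightarrow> 'l set \<Rightarrow> bool"
  where "iota_embeddable L P \<longleftrightarrow> P \<subseteq> carrier L \<and>
    (\<forall>S \<subseteq> P. \<exists>i. is_glb (suborder L P) i S \<and> is_glb L i S) \<and>
    greatest (suborder L P) \<top>\<^bsub>L\<^esub> P"

definition order_isomorphic ::
    "('a, 'c) gorder_scheme \<Rightarrow> ('b, 'd) gorder_scheme \<Rightarrow> bool"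
  where "order_isomorphic A B \<longleftrightarrow>
    (\<exists>f. bij_betw f (carrier A) (carrier B) \<and> order_emb A B f)"

definition embedded_copies :: "('l, 'm) gorder_scheme \<Rightarrow> 'a set set \<Rightarrow> 'l set set"
  where "embedded_copies L F =
    {P. P \<subseteq> carrier L \<and> iota_embeddable L P \<and>
        order_isomorphic (suborder L P) (superset_order F)}"

definition lattice_autos :: "'a set set \<Rightarrow> ('a set \<Rightarrow> 'a set) set"
  where "lattice_autos F =
    {f \<in> F \<rightarrow>\<^sub>E F. bij_betw f F F \<and>
      join_pres (superset_order F) (superset_order F) f \<and>
      meet_pres (superset_order F) (superset_order F) f}"

end

theory Submission
  imports Defs
begin

text \<open>An order-reversing embedding \<open>\<phi>\<close> of \<open>F\<close> into \<open>L\<close> has an \<open>\<iota>\<close>-embedded image iff every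
  \<open>p \<in> L\<close> has a largest \<open>A \<in> F\<close> with \<open>p \<sqsubseteq> \<phi> A\<close>. Such maps \<open>\<phi>\<close> correspond bijectively to the
  fuzzy sets \<open>\<mu>\<close> whose level sets form \<open>F\<close>: \<open>\<phi>\<close> yields \<open>\<mu> x = \<phi> (cl {x})\<close>, where \<open>cl\<close> is the closure
  operator of \<open>F\<close>, and \<open>\<mu>\<close> yields \<open>\<phi> A = \<Sqinter> \<mu> ` A\<close>, the largest \<open>p\<close> whose level set is \<open>A\<close>. Two
  such \<open>\<phi>\<close> with the same image differ by an automorphism of \<open>F\<close>, so \<open>\<phi>\<close> is unique iff there is
  exactly one image and exactly one automorphism.\<close>

text \<open>The last clause makes \<phi> one half of an antitone Galois connection between
  \<open>F\<close> and \<open>L\<close>, with \<open>A\<close> the value of the adjoint at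
  \<open>p\<close>. The extensional function space lets uniqueness be tested by plain equality of
  maps.\<close>

definition residuated_embs :: "('l, 'm) gorder_scheme \<Rightarrow> 'a set set \<Rightarrow> ('a set \<Rightarrow> 'l) set"
  where "residuated_embs L F =
    {\<phi> \<in> F \<rightarrow>\<^sub>E carrier L. (\<forall>A\<in>F. \<forall>B\<in>F. \<phi> A \<sqsubseteq>\<^bsub>L\<^esub> \<phi> B \<longleftrightarrow> B \<subseteq> A) \<and>
      (\<forall>p\<in>carrier L. \<exists>A\<in>F. \<forall>B\<in>F. p \<sqsubseteq>\<^bsub>L\<^esub> \<phi> B \<longleftrightarrow> B \<subseteq> A)}"

definition emb_fuzzy :: "'a set \<Rightarrow> 'a set set \<Rightarrow> ('a set \<Rightarrow> 'l) \<Rightarrow> 'a \<Rightarrow> 'l"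
  where "emb_fuzzy X F \<phi> = (\<lambda>x\<in>X. \<phi> (\<Inter>{A \<in> F. x \<in> A}))"

definition fuzzy_emb :: "('l, 'm) gorder_scheme \<Rightarrow> 'a set set \<Rightarrow> ('a \<Rightarrow> 'l) \<Rightarrow> 'a set \<Rightarrow> 'l"
  where "fuzzy_emb L F \<mu> = (\<lambda>A\<in>F. \<Sqinter>\<^bsub>L\<^esub>(\<mu> ` A))"

section \<open>Reverse inclusion, and order isomorphisms of lattices\<close>

lemma superset_order_simps [simp]:
  "carrier (superset_order F) = F" "le (superset_order F) A B \<longleftrightarrow> B \<subseteq> A"
  "eq (superset_order F) = (=)"
  by (simp_all add: superset_order_def)

lemma partial_order_superset: "partial_order (superset_order F)"
  by unfold_locales auto

text \<open>Surjectivity pulls the join of \<open>f x\<close> and \<open>f y\<close> back to some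
  \<open>z\<close>. Since \<open>f\<close> reflects the order, \<open>z\<close> is an upper bound of
  \<open>x\<close> and \<open>y\<close>, which gives the harder inequality.\<close>

lemma order_iso_join_pres:
  assumes A: "lattice A" and B: "lattice B"
    and bij: "bij_betw f (carrier A) (carrier B)"
    and emb: "\<And>x y. x \<in> carrier A \<Longrightarrow> y \<in> carrier A \<Longrightarrow> f x \<sqsubseteq>\<^bsub>B\<^esub> f y \<longleftrightarrow> x \<sqsubseteq>\<^bsub>A\<^esub> y"
  shows "join_pres A B f"
proof -
  interpret A: lattice A by fact
  interpret B: lattice B by fact
  have im: "f ` carrier A = carrier B" using bij by (simp add: bij_betw_def)
  have "f (x \<squnion>\<^bsub>A\<^esub> y) = f x \<squnion>\<^bsub>B\<^esub> f y" if xy: "x \<in> carrier A" "y \<in> carrier A" for x y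
  proof (rule B.le_antisym)
    have c: "f x \<in> carrier B" "f y \<in> carrier B" using im xy by auto
    then obtain z where z: "z \<in> carrier A" "f z = f x \<squnion>\<^bsub>B\<^esub> f y"
      using im B.join_closed by (metis imageE)
    then have "x \<sqsubseteq>\<^bsub>A\<^esub> z" "y \<sqsubseteq>\<^bsub>A\<^esub> z"
      using emb xy c B.join_left B.join_right by metis+
    then have "x \<squnion>\<^bsub>A\<^esub> y \<sqsubseteq>\<^bsub>A\<^esub> z" using xy z by (simp add: A.join_le)
    then show "f (x \<squnion>\<^bsub>A\<^esub> y) \<sqsubseteq>\<^bsub>B\<^esub> f x \<squnion>\<^bsub>B\<^esub> f y"
      using emb z xy by (metis A.join_closed)
    show "f x \<squnion>\<^bsub>B\<^esub> f y \<sqsubseteq>\<^bsub>B\<^esub> f (x \<squnion>\<^bsub>A\<^esub> y)"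
      using im xy c emb by (intro B.join_le) (auto simp: A.join_left A.join_right)
    show "f (x \<squnion>\<^bsub>A\<^esub> y) \<in> carrier B" using im xy by auto
    show "f x \<squnion>\<^bsub>B\<^esub> f y \<in> carrier B" using c by auto
  qed
  then show ?thesis using A B by (simp add: join_pres_def)
qed

text \<open>Inverting both orders turns joins into meets and keeps \<open>f\<close> an order
  isomorphism.\<close>

lemma order_iso_meet_pres:
  assumes A: "lattice A" and B: "lattice B"
    and bij: "bij_betw f (carrier A) (carrier B)"
    and emb: "\<And>x y. x \<in> carrier A \<Longrightarrow> y \<in> carrier A \<Longrightarrow> f x \<sqsubseteq>\<^bsub>B\<^esub> f y \<longleftrightarrow> x \<sqsubseteq>\<^bsub>A\<^esub> y"
  shows "meet_pres A B f"
proof -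
  have "join_pres (inv_gorder A) (inv_gorder B) f"
    using assms by (intro order_iso_join_pres lattice.dual_lattice) auto
  then show ?thesis using A B by (simp add: join_pres_def meet_pres_def)
qed

section \<open>Closure systems as lattices, and their automorphisms\<close>

locale closure_system =
  fixes X :: "'a set" and F :: "'a set set"
  assumes sub: "F \<subseteq> Pow X" and top_in: "X \<in> F"
    and Inter_in: "\<And>G. G \<subseteq> F \<Longrightarrow> G \<noteq> {} \<Longrightarrow> \<Inter>G \<in> F"
begin

definition cl :: "'a \<Rightarrow> 'a set"
  where "cl x = \<Inter>{A \<in> F. x \<in> A}"

lemma cl_in: "x \<in> X \<Longrightarrow> cl x \<in> F"
  unfolding cl_def using top_in by (intro Inter_in) auto

lemma cl_self: "x \<in> cl x"
  by (auto simp: cl_def)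

lemma cl_subset_iff: "A \<in> F \<Longrightarrow> cl x \<subseteq> A \<longleftrightarrow> x \<in> A"
  by (auto simp: cl_def)

text \<open>Suprema for reverse inclusion are intersections; infima are closures of unions.\<close>

lemma lattice_superset: "lattice (superset_order F)"
proof -
  interpret partial_order "superset_order F" by (rule partial_order_superset)
  have "complete_lattice (superset_order F)"
  proof (rule complete_latticeI)
    fix G assume G: "G \<subseteq> carrier (superset_order F)"
    \<comment> \<open>Inserting \<open>X\<close> makes the empty family yield \<open>X\<close>, the
      least element for reverse inclusion, instead of the universe of the type.\<close>
    have "\<Inter>(insert X G) \<in> F" using G top_in by (intro Inter_in) auto
    then have "least (superset_order F) (\<Inter>(insert X G)) (Upper (superset_order F) G)"
      using G sub by (fastforce simp: least_def Upper_def)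
    then show "\<exists>s. least (superset_order F) s (Upper (superset_order F) G)" ..
    define D where "D = \<Inter>{C \<in> F. \<Union>G \<subseteq> C}"
    have "D \<in> F" unfolding D_def using G top_in sub by (intro Inter_in) auto
    moreover have "A \<subseteq> D" if "A \<in> G" for A using that by (auto simp: D_def)
    moreover have "D \<subseteq> C" if "C \<in> Lower (superset_order F) G" for C
    proof -
      have "C \<in> F" "\<Union>G \<subseteq> C" using that G by (auto simp: Lower_def)
      then show ?thesis unfolding D_def by (intro Inter_lower) simp
    qed
    ultimately have "greatest (superset_order F) D (Lower (superset_order F) G)"
      unfolding greatest_def by (simp add: Lower_def)
    then show "\<exists>i. greatest (superset_order F) i (Lower (superset_order F) G)" ..
  qed
  then show ?thesis by simp
qed

text \<open>Joins determine the order, and injectivity of \<open>f\<close> turns the resulting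
  equation into an equivalence. Conversely, order isomorphisms preserve joins and meets.\<close>

lemma lattice_autos_iff:
  "f \<in> lattice_autos F \<longleftrightarrow>
    f \<in> F \<rightarrow>\<^sub>E F \<and> bij_betw f F F \<and> (\<forall>A\<in>F. \<forall>B\<in>F. f A \<subseteq> f B \<longleftrightarrow> A \<subseteq> B)"
    (is "_ \<longleftrightarrow> ?R")
proof
  interpret lattice "superset_order F" by (rule lattice_superset)
  assume f: "f \<in> lattice_autos F"
  then have inj: "inj_on f F" and c: "\<And>A. A \<in> F \<Longrightarrow> f A \<in> F"
    and j: "\<And>A B. A \<in> F \<Longrightarrow> B \<in> F \<Longrightarrow>
      f (A \<squnion>\<^bsub>superset_order F\<^esub> B) = f A \<squnion>\<^bsub>superset_order F\<^esub> f B"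
    by (auto simp: lattice_autos_def bij_betw_def join_pres_def)
  \<comment> \<open>Despite its name, \<open>le_iff_meet\<close> expresses the order by joins; the
    order being reverse inclusion, \<open>A\<close> and \<open>B\<close> change places.\<close>
  have le: "A \<subseteq> B \<longleftrightarrow> B \<squnion>\<^bsub>superset_order F\<^esub> A = A" if "A \<in> F" "B \<in> F" for A B
    using le_iff_meet[of B A] that by simp
  have "f A \<subseteq> f B \<longleftrightarrow> A \<subseteq> B" if "A \<in> F" "B \<in> F" for A B
  proof -
    have "B \<squnion>\<^bsub>superset_order F\<^esub> A \<in> F" using join_closed that by auto
    then show ?thesis
      using that j[of B A] le[of A B] le[of "f A" "f B"] c inj_on_eq_iff[OF inj] by metis
  qed
  then show ?R using f by (simp add: lattice_autos_def)
next
  assume R: ?R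
  then show "f \<in> lattice_autos F"
    using order_iso_join_pres[OF lattice_superset lattice_superset, of f]
      order_iso_meet_pres[OF lattice_superset lattice_superset, of f]
    by (simp add: lattice_autos_def)
qed

lemma id_lattice_auto: "restrict id F \<in> lattice_autos F"
  by (auto simp: lattice_autos_iff bij_betw_def inj_on_def)

end

section \<open>From embeddings to fuzzy sets\<close>

locale fuzzy_closure_system = closure_system X F + L: complete_lattice L
  for X :: "'a set" and F :: "'a set set" and L :: "('l, 'm) gorder_scheme" (structure)
begin

lemma emb_fuzzy_apply: "x \<in> X \<Longrightarrow> emb_fuzzy X F \<phi> x = \<phi> (cl x)"
  by (simp add: emb_fuzzy_def cl_def)

lemma embsD:
  assumes "\<phi> \<in> residuated_embs L F"
  shows "\<phi> \<in> F \<rightarrow>\<^sub>E carrier L"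
    and "\<And>A. A \<in> F \<Longrightarrow> \<phi> A \<in> carrier L"
    and "\<And>A B. A \<in> F \<Longrightarrow> B \<in> F \<Longrightarrow> \<phi> A \<sqsubseteq> \<phi> B \<longleftrightarrow> B \<subseteq> A"
    and "\<And>p. p \<in> carrier L \<Longrightarrow> \<exists>A\<in>F. \<forall>B\<in>F. p \<sqsubseteq> \<phi> B \<longleftrightarrow> B \<subseteq> A"
  using assms by (auto simp: residuated_embs_def)

lemma embs_inj_on:
  assumes "\<phi> \<in> residuated_embs L F"
  shows "inj_on \<phi> F"
proof (rule inj_onI)
  fix A B assume "A \<in> F" "B \<in> F" "\<phi> A = \<phi> B"
  then show "A = B" using embsD(2,3)[OF assms] L.le_refl by (metis subset_antisym)
qed

lemma emb_fuzzy_closed: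
  assumes "\<phi> \<in> residuated_embs L F"
  shows "emb_fuzzy X F \<phi> \<in> X \<rightarrow>\<^sub>E carrier L"
  using embsD(2)[OF assms] cl_in by (auto simp: emb_fuzzy_apply) (simp add: emb_fuzzy_def)

text \<open>Applying the hypothesis to \<open>B = cl x\<close> reduces membership in the level set
  to \<open>cl x \<subseteq> A\<close>, that is, to \<open>x \<in> A\<close>.\<close>

lemma level_set_emb_fuzzy:
  assumes "\<phi> \<in> residuated_embs L F" "A \<in> F" "\<forall>B\<in>F. p \<sqsubseteq> \<phi> B \<longleftrightarrow> B \<subseteq> A"
  shows "level_set L X (emb_fuzzy X F \<phi>) p = A"
proof -
  have "p \<sqsubseteq> emb_fuzzy X F \<phi> x \<longleftrightarrow> x \<in> A" if "x \<in> X" for x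
    using assms that cl_in by (simp add: emb_fuzzy_apply cl_subset_iff)
  moreover have "A \<subseteq> X" using assms(2) sub by auto
  ultimately show ?thesis by (auto simp: level_set_def)
qed

text \<open>Each \<open>A\<close> in \<open>F\<close> is the level set at \<open>\<phi> A\<close>;
  conversely, the level set at \<open>p\<close> is the largest \<open>A\<close> that residuation
  assigns to \<open>p\<close>.\<close>

lemma level_sets_emb_fuzzy:
  assumes \<phi>: "\<phi> \<in> residuated_embs L F"
  shows "F = level_sets L X (emb_fuzzy X F \<phi>)"
proof (intro equalityI subsetI)
  fix A assume "A \<in> F"
  then show "A \<in> level_sets L X (emb_fuzzy X F \<phi>)"
    using level_set_emb_fuzzy[OF \<phi>, of A "\<phi> A"] embsD(2,3)[OF \<phi>]
    by (auto simp: level_sets_def)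
next
  fix A assume "A \<in> level_sets L X (emb_fuzzy X F \<phi>)"
  then obtain p where p: "p \<in> carrier L" "A = level_set L X (emb_fuzzy X F \<phi>) p"
    by (auto simp: level_sets_def)
  then show "A \<in> F" using embsD(4)[OF \<phi>] level_set_emb_fuzzy[OF \<phi>] by metis
qed

lemma fuzzy_emb_emb_fuzzy:
  assumes \<phi>: "\<phi> \<in> residuated_embs L F"
  shows "fuzzy_emb L F (emb_fuzzy X F \<phi>) = \<phi>"
proof
  fix A
  let ?\<mu> = "emb_fuzzy X F \<phi>"
  show "fuzzy_emb L F ?\<mu> A = \<phi> A"
  proof (cases "A \<in> F")
    case False
    then show ?thesis using embsD(1)[OF \<phi>] by (auto simp: fuzzy_emb_def)
  next
    case A: True
    have im: "?\<mu> ` A \<subseteq> carrier L" using emb_fuzzy_closed[OF \<phi>] sub A by blast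
    let ?q = "\<Sqinter>(?\<mu> ` A)"
    have q: "?q \<in> carrier L" using im by simp
    have \<mu>: "?\<mu> x = \<phi> (cl x)" "cl x \<in> F" "cl x \<subseteq> A" if "x \<in> A" for x
    proof -
      have "x \<in> X" using that A sub by auto
      then show "?\<mu> x = \<phi> (cl x)" "cl x \<in> F" "cl x \<subseteq> A"
        using that A by (simp_all add: emb_fuzzy_apply cl_in cl_subset_iff)
    qed
    \<comment> \<open>Each \<open>cl x\<close> with \<open>x \<in> A\<close> lies inside
      \<open>A\<close>, and \<phi> reverses inclusion.\<close>
    have "\<phi> A \<sqsubseteq> ?q"
      using im embsD(2,3)[OF \<phi>] A \<mu> by (intro L.inf_greatest) auto
    moreover have "?q \<sqsubseteq> \<phi> A"
    proof -
      \<comment> \<open>Residuation at the infimum itself: \<open>B\<close> contains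
        \<open>cl x\<close> for every \<open>x \<in> A\<close>, hence all of
        \<open>A\<close>.\<close>
      obtain B where B: "B \<in> F" "\<forall>C\<in>F. ?q \<sqsubseteq> \<phi> C \<longleftrightarrow> C \<subseteq> B"
        using embsD(4)[OF \<phi> q] by auto
      have "cl x \<subseteq> B" if "x \<in> A" for x
        using B \<mu>[OF that] L.inf_lower[OF im] that by (metis imageI)
      then have "A \<subseteq> B" using cl_self by blast
      then show ?thesis using B A by simp
    qed
    ultimately show ?thesis using q embsD(2)[OF \<phi> A] A by (auto simp: fuzzy_emb_def)
  qed
qed

section \<open>From fuzzy sets to embeddings\<close>

context
  fixes \<mu>
  assumes \<mu>_closed: "\<mu> \<in> X \<rightarrow>\<^sub>E carrier L" and F_eq: "F = level_sets L X \<mu>"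
begin

lemma \<mu>_image: "A \<in> F \<Longrightarrow> \<mu> ` A \<subseteq> carrier L"
  using \<mu>_closed sub by blast

lemma le_fuzzy_emb_iff:
  assumes "A \<in> F" "p \<in> carrier L"
  shows "p \<sqsubseteq> fuzzy_emb L F \<mu> A \<longleftrightarrow> A \<subseteq> level_set L X \<mu> p"
proof
  assume le: "p \<sqsubseteq> fuzzy_emb L F \<mu> A"
  show "A \<subseteq> level_set L X \<mu> p"
  proof
    fix x assume x: "x \<in> A"
    have "\<mu> x \<in> carrier L" using \<mu>_image[OF assms(1)] x by auto
    moreover have "fuzzy_emb L F \<mu> A \<sqsubseteq> \<mu> x" "fuzzy_emb L F \<mu> A \<in> carrier L"
      using assms x L.inf_lower[OF \<mu>_image] \<mu>_image by (auto simp: fuzzy_emb_def)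
    ultimately show "x \<in> level_set L X \<mu> p"
      using le assms x sub L.le_trans by (auto simp: level_set_def)
  qed
next
  assume "A \<subseteq> level_set L X \<mu> p"
  then have "p \<sqsubseteq> \<Sqinter>(\<mu> ` A)"
    using assms \<mu>_image[OF assms(1)] by (intro L.inf_greatest) (auto simp: level_set_def)
  then show "p \<sqsubseteq> fuzzy_emb L F \<mu> A" using assms by (simp add: fuzzy_emb_def)
qed

lemma level_set_fuzzy_emb:
  assumes A: "A \<in> F"
  shows "fuzzy_emb L F \<mu> A \<in> carrier L" "level_set L X \<mu> (fuzzy_emb L F \<mu> A) = A"
proof -
  show c: "fuzzy_emb L F \<mu> A \<in> carrier L" using A \<mu>_image by (simp add: fuzzy_emb_def)
  obtain p where p: "p \<in> carrier L" "A = level_set L X \<mu> p"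
    using A by (subst (asm) F_eq) (auto simp: level_sets_def)
  \<comment> \<open>Passing from \<open>p\<close> up to the infimum can only shrink the level set,
    so it stays within \<open>A\<close>.\<close>
  have "p \<sqsubseteq> fuzzy_emb L F \<mu> A" using le_fuzzy_emb_iff[OF A p(1)] p by simp
  then have "p \<sqsubseteq> \<mu> x" if "x \<in> X" "fuzzy_emb L F \<mu> A \<sqsubseteq> \<mu> x" for x
    using that p(1) c \<mu>_closed L.le_trans[of p "fuzzy_emb L F \<mu> A" "\<mu> x"] by auto
  then have "level_set L X \<mu> (fuzzy_emb L F \<mu> A) \<subseteq> A"
    unfolding p(2) by (auto simp: level_set_def)
  moreover have "A \<subseteq> level_set L X \<mu> (fuzzy_emb L F \<mu> A)"
    using le_fuzzy_emb_iff[OF A c] c by simp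
  ultimately show "level_set L X \<mu> (fuzzy_emb L F \<mu> A) = A" by blast
qed

lemma level_set_in: "p \<in> carrier L \<Longrightarrow> level_set L X \<mu> p \<in> F"
  by (subst F_eq) (auto simp: level_sets_def)

lemma fuzzy_emb_residuated: "fuzzy_emb L F \<mu> \<in> residuated_embs L F"
  unfolding residuated_embs_def
proof (intro CollectI conjI ballI)
  show "fuzzy_emb L F \<mu> \<in> F \<rightarrow>\<^sub>E carrier L"
    using level_set_fuzzy_emb(1) by (auto simp: fuzzy_emb_def)
  show "fuzzy_emb L F \<mu> A \<sqsubseteq> fuzzy_emb L F \<mu> B \<longleftrightarrow> B \<subseteq> A" if "A \<in> F" "B \<in> F" for A B
    using that level_set_fuzzy_emb le_fuzzy_emb_iff by metis
  show "\<exists>A\<in>F. \<forall>B\<in>F. p \<sqsubseteq> fuzzy_emb L F \<mu> B \<longleftrightarrow> B \<subseteq> A" if "p \<in> carrier L" for p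
    using that by (intro bexI[of _ "level_set L X \<mu> p"]) (simp_all add: le_fuzzy_emb_iff level_set_in)
qed

text \<open>The level set at \<open>\<mu> x\<close> is a member of \<open>F\<close> containing
  \<open>x\<close>, so it contains \<open>cl x\<close>, and \<open>\<mu> x\<close> is below the
  infimum over \<open>cl x\<close>. The other inequality holds because
  \<open>x \<in> cl x\<close>.\<close>

lemma emb_fuzzy_fuzzy_emb: "emb_fuzzy X F (fuzzy_emb L F \<mu>) = \<mu>"
proof
  fix x
  show "emb_fuzzy X F (fuzzy_emb L F \<mu>) x = \<mu> x"
  proof (cases "x \<in> X")
    case False
    then show ?thesis using \<mu>_closed by (auto simp: emb_fuzzy_def)
  next
    case x: True
    then have c: "\<mu> x \<in> carrier L" using \<mu>_closed by auto
    have "x \<in> level_set L X \<mu> (\<mu> x)" using x c by (simp add: level_set_def)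
    then have "\<mu> x \<sqsubseteq> fuzzy_emb L F \<mu> (cl x)"
      using le_fuzzy_emb_iff[OF cl_in[OF x] c] level_set_in[OF c] cl_subset_iff by blast
    moreover have "fuzzy_emb L F \<mu> (cl x) \<sqsubseteq> \<mu> x"
      using level_set_fuzzy_emb(2)[OF cl_in[OF x]] cl_self by (force simp: level_set_def)
    ultimately show ?thesis
      using c x level_set_fuzzy_emb(1)[OF cl_in[OF x]] by (auto simp: emb_fuzzy_apply)
  qed
qed

end

text \<open>\<open>emb_fuzzy\<close> and \<open>fuzzy_emb\<close> are mutually inverse, so unique
  existence transfers in both directions.\<close>

lemma unique_fuzzy_iff:
  "(\<exists>!\<mu>. \<mu> \<in> X \<rightarrow>\<^sub>E carrier L \<and> F = level_sets L X \<mu>) \<longleftrightarrow> (\<exists>!\<phi>. \<phi> \<in> residuated_embs L F)"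
proof
  assume "\<exists>!\<mu>. \<mu> \<in> X \<rightarrow>\<^sub>E carrier L \<and> F = level_sets L X \<mu>"
  then obtain \<mu> where \<mu>: "\<mu> \<in> X \<rightarrow>\<^sub>E carrier L" "F = level_sets L X \<mu>"
    and uniq: "\<And>\<nu>. \<nu> \<in> X \<rightarrow>\<^sub>E carrier L \<Longrightarrow> F = level_sets L X \<nu> \<Longrightarrow> \<nu> = \<mu>" by metis
  show "\<exists>!\<phi>. \<phi> \<in> residuated_embs L F"
  proof (rule ex1I)
    show "fuzzy_emb L F \<mu> \<in> residuated_embs L F" using \<mu> by (rule fuzzy_emb_residuated)
    show "\<psi> = fuzzy_emb L F \<mu>" if "\<psi> \<in> residuated_embs L F" for \<psi>
      using uniq[OF emb_fuzzy_closed level_sets_emb_fuzzy] fuzzy_emb_emb_fuzzy that by metis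
  qed
next
  assume "\<exists>!\<phi>. \<phi> \<in> residuated_embs L F"
  then obtain \<phi> where \<phi>: "\<phi> \<in> residuated_embs L F"
    and uniq: "\<And>\<psi>. \<psi> \<in> residuated_embs L F \<Longrightarrow> \<psi> = \<phi>" by metis
  show "\<exists>!\<mu>. \<mu> \<in> X \<rightarrow>\<^sub>E carrier L \<and> F = level_sets L X \<mu>"
  proof (rule ex1I, rule conjI)
    show "emb_fuzzy X F \<phi> \<in> X \<rightarrow>\<^sub>E carrier L" using \<phi> by (rule emb_fuzzy_closed)
    show "F = level_sets L X (emb_fuzzy X F \<phi>)" using \<phi> by (rule level_sets_emb_fuzzy)
    show "\<nu> = emb_fuzzy X F \<phi>" if "\<nu> \<in> X \<rightarrow>\<^sub>E carrier L \<and> F = level_sets L X \<nu>" for \<nu>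
      using uniq[OF fuzzy_emb_residuated] emb_fuzzy_fuzzy_emb that by metis
  qed
qed

section \<open>Embedded copies as images of embeddings\<close>

lemma iota_embeddable_image:
  assumes \<phi>: "\<phi> \<in> residuated_embs L F"
  shows "iota_embeddable L (\<phi> ` F)"
proof -
  let ?P = "\<phi> ` F"
  have P: "?P \<subseteq> carrier L" using embsD(2)[OF \<phi>] by auto
  \<comment> \<open>Residuation at \<open>\<Sqinter>S\<close> gives \<open>A\<close> with
    \<open>\<Sqinter>S \<sqsubseteq> \<phi> A\<close>. Every \<open>\<phi> B\<close> in
    \<open>S\<close> is above \<open>\<Sqinter>S\<close>, so \<open>B \<subseteq> A\<close> and
    \<open>\<phi> A\<close> is a lower bound of \<open>S\<close>; hence the two are equal.\<close>
  have inf_in: "\<Sqinter>S \<in> ?P" if S: "S \<subseteq> ?P" for S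
  proof -
    have SL: "S \<subseteq> carrier L" using S P by auto
    obtain A where A: "A \<in> F" "\<forall>B\<in>F. \<Sqinter>S \<sqsubseteq> \<phi> B \<longleftrightarrow> B \<subseteq> A"
      using embsD(4)[OF \<phi>, of "\<Sqinter>S"] SL by auto
    have "\<phi> A \<sqsubseteq> s" if "s \<in> S" for s
    proof -
      obtain B where B: "B \<in> F" "s = \<phi> B" using S \<open>s \<in> S\<close> by blast
      then show ?thesis using A L.inf_lower[OF SL \<open>s \<in> S\<close>] embsD(3)[OF \<phi>] by auto
    qed
    then have "\<phi> A \<sqsubseteq> \<Sqinter>S" using SL A embsD(2)[OF \<phi>] by (intro L.inf_greatest) auto
    then have "\<Sqinter>S = \<phi> A" using A SL embsD(2)[OF \<phi>] by (intro L.le_antisym) auto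
    then show ?thesis using A(1) by (rule image_eqI)
  qed
  have "is_glb (suborder L ?P) (\<Sqinter>S) S \<and> is_glb L (\<Sqinter>S) S" if S: "S \<subseteq> ?P" for S
  proof -
    have glb: "is_glb L (\<Sqinter>S) S" using S P by (intro L.inf_glb) auto
    then have "is_glb (suborder L ?P) (\<Sqinter>S) S"
      using inf_in[OF S] P S unfolding greatest_def Lower_def
      by (simp add: subset_iff Ball_def)
    with glb show ?thesis by blast
  qed
  moreover have "greatest (suborder L ?P) \<top> ?P"
  proof -
    \<comment> \<open>The top element is covered by closure under infima, as the infimum of the
      empty set.\<close>
    have "\<Sqinter>{} = \<top>" using L.weak_inf_empty by (simp add: L.eq_is_equal)
    then have "\<top> \<in> ?P" using inf_in[of "{}"] by simp
    then show ?thesis using P by (auto simp: greatest_def intro: L.top_higher)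
  qed
  ultimately show ?thesis using P by (auto simp: iota_embeddable_def)
qed

lemma image_in_embedded_copies:
  assumes \<phi>: "\<phi> \<in> residuated_embs L F"
  shows "\<phi> ` F \<in> embedded_copies L F"
proof -
  let ?P = "\<phi> ` F" and ?g = "inv_into F \<phi>"
  have P: "?P \<subseteq> carrier L" using embsD(2)[OF \<phi>] by auto
  have bij: "bij_betw ?g ?P F"
    using embs_inj_on[OF \<phi>] by (simp add: bij_betw_inv_into bij_betw_imageI)
  have wo: "weak_partial_order (suborder L ?P)"
    using L.weak_partial_order_axioms P by (rule weak_partial_order_subset)
  have wo': "weak_partial_order (superset_order F)"
    using partial_order_superset by (rule partial_order.axioms)
  have "order_emb (suborder L ?P) (superset_order F) ?g"
    using embsD(3)[OF \<phi>] embs_inj_on[OF \<phi>] wo wo' by (auto simp: order_emb_def)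
  then show ?thesis
    using bij P iota_embeddable_image[OF \<phi>]
    by (auto simp: embedded_copies_def order_isomorphic_def)
qed

lemma embedded_copy_is_image:
  assumes P: "P \<in> embedded_copies L F"
  obtains \<phi> where "\<phi> \<in> residuated_embs L F" "\<phi> ` F = P"
proof -
  from P obtain g where PL: "P \<subseteq> carrier L" and iota: "iota_embeddable L P"
    and bij: "bij_betw g P F" and emb: "order_emb (suborder L P) (superset_order F) g"
    by (auto simp: embedded_copies_def order_isomorphic_def)
  define \<phi> where "\<phi> = restrict (inv_into P g) F"
  have im: "\<phi> ` F = P"
    using bij_betw_inv_into[OF bij] by (simp add: \<phi>_def bij_betw_def)
  have le: "\<phi> A \<sqsubseteq> \<phi> B \<longleftrightarrow> B \<subseteq> A" if "A \<in> F" "B \<in> F" for A B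
  proof -
    have "inv_into P g A \<in> P" "inv_into P g B \<in> P" "g (inv_into P g A) = A" "g (inv_into P g B) = B"
      using that bij by (auto simp: bij_betw_def inv_into_into f_inv_into_f)
    moreover from this(1,2) have "inv_into P g A \<sqsubseteq> inv_into P g B \<longleftrightarrow>
        g (inv_into P g B) \<subseteq> g (inv_into P g A)"
      using emb by (simp add: order_emb_def)
    ultimately show ?thesis using that by (simp add: \<phi>_def)
  qed
  have "\<exists>A\<in>F. \<forall>B\<in>F. p \<sqsubseteq> \<phi> B \<longleftrightarrow> B \<subseteq> A" if p: "p \<in> carrier L" for p
  proof -
    \<comment> \<open>The infimum \<open>i\<close> of \<open>?S\<close> is the least element of
      \<open>P\<close> above \<open>p\<close>: it belongs to \<open>P\<close> as an infimum there,
      and lies above \<open>p\<close> as an infimum in \<open>L\<close>. Its preimage under \<phi>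
      is the required \<open>A\<close>.\<close>
    let ?S = "{q \<in> P. p \<sqsubseteq> q}"
    have "?S \<subseteq> P" by blast
    then obtain i where i: "is_glb (suborder L P) i ?S" "is_glb L i ?S"
      using iota unfolding iota_embeddable_def by metis
    have "i \<in> P" using i(1) by (auto simp: greatest_def Lower_def)
    then obtain A where A: "A \<in> F" "\<phi> A = i" using im by auto
    have pi: "p \<sqsubseteq> i" using i(2) p by (auto simp: greatest_def Lower_def)
    have lower: "i \<sqsubseteq> q" if "q \<in> P" "p \<sqsubseteq> q" for q
      using i(2) that PL by (auto simp: greatest_def Lower_def)
    have "p \<sqsubseteq> \<phi> B \<longleftrightarrow> \<phi> A \<sqsubseteq> \<phi> B" if "B \<in> F" for B
    proof -
      have "\<phi> B \<in> P" using that im by auto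
      then show ?thesis
        using A pi lower[of "\<phi> B"] p subsetD[OF PL] \<open>i \<in> P\<close> L.le_trans[of p i "\<phi> B"] by metis
    qed
    then show ?thesis using A(1) le by (intro bexI[of _ A]) simp_all
  qed
  moreover have "\<phi> \<in> F \<rightarrow>\<^sub>E carrier L" using im PL by (auto simp: \<phi>_def)
  ultimately have "\<phi> \<in> residuated_embs L F" using le by (simp add: residuated_embs_def)
  with im show thesis using that by blast
qed

section \<open>Automorphisms acting on embeddings\<close>

lemma emb_comp_auto:
  assumes \<phi>: "\<phi> \<in> residuated_embs L F" and f: "f \<in> lattice_autos F"
  shows "restrict (\<phi> \<circ> f) F \<in> residuated_embs L F"
proof -
  have bij: "bij_betw f F F" and fF: "\<And>A. A \<in> F \<Longrightarrow> f A \<in> F"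
    and le: "\<And>A B. A \<in> F \<Longrightarrow> B \<in> F \<Longrightarrow> f A \<subseteq> f B \<longleftrightarrow> A \<subseteq> B"
    using f by (auto simp: lattice_autos_iff)
  have "\<exists>A\<in>F. \<forall>B\<in>F. p \<sqsubseteq> \<phi> (f B) \<longleftrightarrow> B \<subseteq> A" if p: "p \<in> carrier L" for p
  proof -
    obtain A where "A \<in> F" "\<forall>B\<in>F. p \<sqsubseteq> \<phi> B \<longleftrightarrow> B \<subseteq> A" using embsD(4)[OF \<phi> p] by auto
    \<comment> \<open>The largest set for the composite is the preimage under \<open>f\<close> of
      the one for \<phi>.\<close>
    moreover obtain C where "C \<in> F" "A = f C"
      using bij \<open>A \<in> F\<close> by (auto simp: bij_betw_def)
    ultimately show ?thesis using fF le by (intro bexI[of _ C]) simp_all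
  qed
  then show ?thesis using embsD(2,3)[OF \<phi>] fF le by (auto simp: residuated_embs_def)
qed

text \<open>The automorphism is \<psi> followed by the inverse of \<phi> on the common image; both
  maps reverse inclusion, so the composite preserves it.\<close>

lemma same_image_auto:
  assumes \<phi>: "\<phi> \<in> residuated_embs L F" and \<psi>: "\<psi> \<in> residuated_embs L F"
    and im: "\<phi> ` F = \<psi> ` F"
  obtains f where "f \<in> lattice_autos F" "\<And>A. A \<in> F \<Longrightarrow> \<phi> (f A) = \<psi> A"
proof -
  define f where "f = restrict (inv_into F \<phi> \<circ> \<psi>) F"
  have f: "f A \<in> F" "\<phi> (f A) = \<psi> A" if "A \<in> F" for A
  proof -
    have "\<psi> A \<in> \<phi> ` F" using im that by auto
    then show "f A \<in> F" "\<phi> (f A) = \<psi> A"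
      using that by (auto simp: f_def inv_into_into f_inv_into_f)
  qed
  have le: "f A \<subseteq> f B \<longleftrightarrow> A \<subseteq> B" if "A \<in> F" "B \<in> F" for A B
    using f that embsD(3)[OF \<phi>] embsD(3)[OF \<psi>] by metis
  have "inj_on f F" using le by (intro inj_onI) (metis subset_antisym subset_refl)
  moreover have "f ` F = F"
  proof (intro equalityI subsetI)
    fix A assume A: "A \<in> F"
    then obtain B where B: "B \<in> F" "\<phi> A = \<psi> B" using im by (metis imageE imageI)
    then have "A = f B" using f[of B] A inj_onD[OF embs_inj_on[OF \<phi>]] by metis
    then show "A \<in> f ` F" using B by auto
  qed (use f in auto)
  moreover have "f \<in> F \<rightarrow>\<^sub>E F" using f by (auto simp: f_def)
  ultimately have "f \<in> lattice_autos F"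
    using le by (simp add: lattice_autos_iff bij_betw_def)
  with f show thesis using that by blast
qed

lemma unique_emb_iff:
  "(\<exists>!\<phi>. \<phi> \<in> residuated_embs L F) \<longleftrightarrow>
    card (embedded_copies L F) = 1 \<and> card (lattice_autos F) = 1"
proof
  assume "\<exists>!\<phi>. \<phi> \<in> residuated_embs L F"
  then obtain \<phi> where \<phi>: "\<phi> \<in> residuated_embs L F"
    and uniq: "\<And>\<psi>. \<psi> \<in> residuated_embs L F \<Longrightarrow> \<psi> = \<phi>" by auto
  have "embedded_copies L F = {\<phi> ` F}"
    using image_in_embedded_copies[OF \<phi>] uniq embedded_copy_is_image
    by (metis subsetI subset_antisym singletonD singletonI)
  moreover have "lattice_autos F = {restrict id F}"
  proof -
    have "f = restrict id F" if f: "f \<in> lattice_autos F" for f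
    proof (rule extensionalityI[of _ F])
      show "f \<in> extensional F" "restrict id F \<in> extensional F"
        using f by (auto simp: lattice_autos_def PiE_def)
      fix A assume A: "A \<in> F"
      \<comment> \<open>Uniqueness forces \<phi> composed with \<open>f\<close> to be \<phi> again,
        and \<phi> is injective.\<close>
      have "\<phi> (f A) = \<phi> A"
        using fun_cong[OF uniq[OF emb_comp_auto[OF \<phi> f]], of A] A by simp
      then show "f A = restrict id F A"
        using A f inj_onD[OF embs_inj_on[OF \<phi>]] by (auto simp: lattice_autos_def)
    qed
    then show ?thesis using id_lattice_auto by blast
  qed
  ultimately show "card (embedded_copies L F) = 1 \<and> card (lattice_autos F) = 1" by simp
next
  assume "card (embedded_copies L F) = 1 \<and> card (lattice_autos F) = 1"
  \<comment> \<open>Infinite sets have \<open>card\<close> 0, so the value 1 really means a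
    singleton.\<close>
  then obtain P f\<^sub>0 where P: "embedded_copies L F = {P}" and f0: "lattice_autos F = {f\<^sub>0}"
    by (auto simp: card_1_singleton_iff)
  obtain \<phi> where \<phi>: "\<phi> \<in> residuated_embs L F" "\<phi> ` F = P"
    using embedded_copy_is_image[of P] P by auto
  have "\<psi> = \<phi>" if \<psi>: "\<psi> \<in> residuated_embs L F" for \<psi>
  proof -
    have "\<phi> ` F = \<psi> ` F" using image_in_embedded_copies[OF \<psi>] P \<phi> by auto
    then obtain f where f: "f \<in> lattice_autos F" "\<And>A. A \<in> F \<Longrightarrow> \<phi> (f A) = \<psi> A"
      using same_image_auto[OF \<phi>(1) \<psi>] by metis
    \<comment> \<open>The identity is always an automorphism, so it is the only one.\<close>
    have "f = restrict id F" using f(1) f0 id_lattice_auto by auto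
    then have "\<phi> A = \<psi> A" if "A \<in> F" for A using f(2)[OF that] that by simp
    then show ?thesis using embsD(1)[OF \<phi>(1)] embsD(1)[OF \<psi>] by (metis PiE_ext)
  qed
  with \<phi> show "\<exists>!\<phi>. \<phi> \<in> residuated_embs L F" by blast
qed

end

theorem theorem11:
  fixes X :: "'a set" and F :: "'a set set" and L :: "('l, 'm) gorder_scheme"
  assumes "X \<noteq> {}"
    and "F \<subseteq> Pow X"
    and "X \<in> F"
    and "\<And>G. G \<subseteq> F \<Longrightarrow> G \<noteq> {} \<Longrightarrow> \<Inter>G \<in> F"
    and "complete_lattice L"
  shows "(\<exists>!\<mu>. \<mu> \<in> X \<rightarrow>\<^sub>E carrier L \<and> F = level_sets L X \<mu>) \<longleftrightarrow>
    card (embedded_copies L F) = 1 \<and> card (lattice_autos F) = 1"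
proof -
  interpret fuzzy_closure_system X F L
    using assms(2-5) by (intro fuzzy_closure_system.intro closure_system.intro)
  show ?thesis using unique_fuzzy_iff unique_emb_iff by simp
qed

end
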